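(* Let $\alpha,\beta\in\mathbb{C}$ be fixed with $\alpha+\beta\neq 0$, and let $$\mathfrak{h}=\left\{\begin{pmatrix} x_1+x_2 & x_1+x_2 & 0 & x_1\\ x_1+x_2 & x_1+x_2 & 0 & x_2\\ \alpha x_1+(\beta-1)x_2 & \beta x_1+(\alpha+1)x_2 & 0 & x_3\\ 0&0&0&0\end{pmatrix} : x_1,x_2,x_3\in\mathbb{C}\right\}\subset gl(4,\mathbb{C}).$$ Then the $3$-dimensional nilpotent Lie subalgebra $\mathfrak{h}$ of $gl(4,\mathbb{C})$ is not algebraic.
   Context: For a finite-dimensional vector space $V$ over an algebraically closed field $\mathbb{K}$ of characteristic $0$, $gl(V)$ denotes the Lie algebra of endomorphisms of $V$ with bracket $[f,g]=f\circ g-g\circ f$, and $\mathrm{Aut}(V)$ the group of linear automorphisms of $V$; $gl(4,\mathbb{C})=gl(\mathbb{C}^4)$. A subgroup $G\subset \mathrm{Aut}(V)$ is an algebraic group if there is a set $S$ of polynomial functions on $\mathrm{Aut}(V)$ with $G=\{f\in \mathrm{Aut}(V) : P(f)=0 \text{ for all } P\in S\}$. The Lie algebra of $G$ is the subalgebra of $gl(V)$ of all $X$ such that $dP(X)=0$ (differential at the identity) for every $P\in I(G)$, where $I(G)$ is the ideal of polynomial functions vanishing on $G$. A Lie subalgebra of $gl(V)$ is called algebraic if it is the Lie algebra of some algebraic group of automorphisms of $V$. *)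

theory Defs
  imports "HOL-Analysis.Analysis" "HOL-Algebra.Group"
begin

text \<open>
  Endomorphisms of \<open>V = \<complex>\<^sup>n\<close> are represented by their matrices, of type \<open>complex ^ 'n ^ 'n\<close>;
  composition is \<open>**\<close>. The library's \<open>*s\<close> on this type multiplies every row componentwise by a vector,
  so scalar multiplication by a complex number is introduced separately.
\<close>

definition mat_scale :: "complex \<Rightarrow> complex ^ 'n ^ 'n \<Rightarrow> complex ^ 'n ^ 'n" where
  "mat_scale c A = (\<chi> i j. c * A $ i $ j)"

interpretation gl: vector_space "mat_scale :: complex \<Rightarrow> complex ^ 'n ^ 'n \<Rightarrow> complex ^ 'n ^ 'n"
  by unfold_locales (simp_all add: mat_scale_def vec_eq_iff algebra_simps)

definition lie_bracket ::
    "complex ^ 'n ^ 'n \<Rightarrow> complex ^ 'n ^ 'n \<Rightarrow> complex ^ 'n ^ 'n" where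
  "lie_bracket A B = A ** B - B ** A"

definition lie_subalgebra :: "(complex ^ 'n ^ 'n) set \<Rightarrow> bool" where
  "lie_subalgebra L \<longleftrightarrow> gl.subspace L \<and> (\<forall>A\<in>L. \<forall>B\<in>L. lie_bracket A B \<in> L)"

primrec lower_central_series ::
    "(complex ^ 'n ^ 'n) set \<Rightarrow> nat \<Rightarrow> (complex ^ 'n ^ 'n) set" where
  "lower_central_series L 0 = L"
| "lower_central_series L (Suc k) =
     gl.span {lie_bracket A B | A B. A \<in> L \<and> B \<in> lower_central_series L k}"

definition nilpotent_lie :: "(complex ^ 'n ^ 'n) set \<Rightarrow> bool" where
  "nilpotent_lie L \<longleftrightarrow> (\<exists>k. lower_central_series L k = {0})"

definition Aut :: "(complex ^ 'n ^ 'n) monoid" where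
  "Aut = \<lparr>carrier = {A. invertible A}, monoid.mult = (**), one = mat 1\<rparr>"

text \<open>
  Polynomial functions in the matrix entries. They are taken on all matrices; since the
  automorphisms are Zariski dense among these, they are the same thing as their restrictions
  to the automorphisms.
\<close>

inductive_set polynomial_functions :: "(complex ^ 'n ^ 'n \<Rightarrow> complex) set" where
  const: "(\<lambda>A. c) \<in> polynomial_functions"
| entry: "(\<lambda>A. A $ i $ j) \<in> polynomial_functions"
| add: "P \<in> polynomial_functions \<Longrightarrow> Q \<in> polynomial_functions \<Longrightarrow>
    (\<lambda>A. P A + Q A) \<in> polynomial_functions"
| mult: "P \<in> polynomial_functions \<Longrightarrow> Q \<in> polynomial_functions \<Longrightarrow>
    (\<lambda>A. P A * Q A) \<in> polynomial_functions"

definition algebraic_group :: "(complex ^ 'n ^ 'n) set \<Rightarrow> bool" where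
  "algebraic_group G \<longleftrightarrow> subgroup G Aut \<and>
     (\<exists>S \<subseteq> polynomial_functions. G = {A \<in> carrier Aut. \<forall>P\<in>S. P A = 0})"

definition vanishing_ideal ::
    "(complex ^ 'n ^ 'n) set \<Rightarrow> (complex ^ 'n ^ 'n \<Rightarrow> complex) set" where
  "vanishing_ideal G = {P \<in> polynomial_functions. \<forall>A\<in>G. P A = 0}"

text \<open>
  The Frechet derivative is the real one; for a polynomial function it is complex linear and
  coincides with the complex differential.
\<close>

definition lie_algebra_of :: "(complex ^ 'n ^ 'n) set \<Rightarrow> (complex ^ 'n ^ 'n) set" where
  "lie_algebra_of G =
     {X. \<forall>P \<in> vanishing_ideal G. frechet_derivative P (at (mat 1)) X = 0}"

definition algebraic_lie_subalgebra :: "(complex ^ 'n ^ 'n) set \<Rightarrow> bool" where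
  "algebraic_lie_subalgebra L \<longleftrightarrow>
     lie_subalgebra L \<and> (\<exists>G. algebraic_group G \<and> L = lie_algebra_of G)"

definition \<hh> :: "complex \<Rightarrow> complex \<Rightarrow> (complex ^ 4 ^ 4) set" where
  "\<hh> \<alpha> \<beta> = {vector
     [vector [x1 + x2, x1 + x2, 0, x1],
      vector [x1 + x2, x1 + x2, 0, x2],
      vector [\<alpha> * x1 + (\<beta> - 1) * x2, \<beta> * x1 + (\<alpha> + 1) * x2, 0, x3],
      vector [0, 0, 0, 0]] | x1 x2 x3. True}"

text \<open>The list entries of \<open>vector\<close> are the components 1, 2, 3 and 4 (which is 0 in type \<open>4\<close>).\<close>

lemma vector_4:
  fixes w x y z :: "'a::zero"
  shows "(vector [w, x, y, z] :: 'a ^ 4) $ 1 = w" "(vector [w, x, y, z] :: 'a ^ 4) $ 2 = x"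
    "(vector [w, x, y, z] :: 'a ^ 4) $ 3 = y" "(vector [w, x, y, z] :: 'a ^ 4) $ 4 = z"
  unfolding vector_def by simp_all

end

theory Submission
  imports Defs "HOL-Complex_Analysis.Complex_Analysis"
begin

text \<open>
  The Lie algebra of a group contains the nilpotent part \<open>N\<close> of each of its
  elements \<open>X = S + N\<close> with \<open>S\<^sup>2 = c S\<close>, \<open>c \<noteq> 0\<close>, and \<open>N\<^sup>2 = N S = S N = 0\<close>. Indeed, a polynomial
  \<open>P\<close> vanishing on the group vanishes along \<open>exp (z X) = 1 + z N + (exp (c z) - 1) / c \<cdot> S\<close>,
  since all derivatives of \<open>z \<mapsto> P (exp (z X))\<close> at \<open>0\<close> vanish. At the points
  \<open>z = 2 \<pi> i m / c\<close> this says that \<open>P (1 + z N) = 0\<close>; being polynomial in \<open>z\<close> with infinitely many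
  zeros, \<open>P (1 + z N)\<close> vanishes identically, whence \<open>dP(N) = 0\<close>. For a suitable element of
  \<open>\<hh> \<alpha> \<beta>\<close> the matrix \<open>N\<close> lies outside \<open>\<hh> \<alpha> \<beta>\<close>.
\<close>

section \<open>Polynomial functions of matrices\<close>

lemma polynomial_function_sum:
  assumes "finite I" "\<And>i. i \<in> I \<Longrightarrow> P i \<in> polynomial_functions"
  shows "(\<lambda>A. \<Sum>i\<in>I. P i A) \<in> polynomial_functions"
  using assms
  by (induction I rule: finite_induct) (auto intro: polynomial_functions.intros)

lemma polynomial_function_entry_mult_right:
  "(\<lambda>A. (A ** X) $ i $ j) \<in> polynomial_functions"
  unfolding matrix_matrix_mult_def
  by (auto intro!: polynomial_function_sum polynomial_functions.intros)

lemma polynomial_function_left_translate: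
  assumes "P \<in> polynomial_functions"
  shows "(\<lambda>A. P (B ** A)) \<in> polynomial_functions"
  using assms
proof induction
  case (entry i j)
  show ?case
    unfolding matrix_matrix_mult_def
    by (auto intro!: polynomial_function_sum polynomial_functions.intros)
qed (auto intro: polynomial_functions.intros)

lemma has_derivative_entry:
  "((\<lambda>A. A $ i $ j) has_derivative (\<lambda>H. H $ i $ j)) (at (A :: complex ^ 'n ^ 'm))"
  by (intro bounded_linear_imp_has_derivative bounded_linear_compose[OF bounded_linear_vec_nth]
      bounded_linear_vec_nth)

text \<open>\<open>frechet_derivative\<close> is a choice operator, meaningful only where a
  derivative exists; this opens it to the calculus rules.\<close>

lemma polynomial_function_differentiable:
  assumes "P \<in> polynomial_functions"
  shows "P differentiable (at A)"
  using assms
  by induction (auto intro: differentiableI[OF has_derivative_entry])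

lemma polynomial_function_has_derivative:
  assumes "P \<in> polynomial_functions"
  shows "(P has_derivative frechet_derivative P (at A)) (at A)"
  using polynomial_function_differentiable[OF assms] frechet_derivative_works by blast

lemma frechet_derivative_entry:
  "frechet_derivative (\<lambda>A. A $ i $ j) (at (A :: complex ^ 'n ^ 'm)) = (\<lambda>H. H $ i $ j)"
  by (rule frechet_derivative_at[OF has_derivative_entry, symmetric])

lemma frechet_derivative_polynomial_add:
  assumes "P \<in> polynomial_functions" "Q \<in> polynomial_functions"
  shows "frechet_derivative (\<lambda>A. P A + Q A) (at A) =
    (\<lambda>H. frechet_derivative P (at A) H + frechet_derivative Q (at A) H)"
  by (rule frechet_derivative_at[symmetric])
    (intro has_derivative_add polynomial_function_has_derivative assms)

lemma frechet_derivative_polynomial_mult: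
  assumes "P \<in> polynomial_functions" "Q \<in> polynomial_functions"
  shows "frechet_derivative (\<lambda>A. P A * Q A) (at A) =
    (\<lambda>H. P A * frechet_derivative Q (at A) H + frechet_derivative P (at A) H * Q A)"
  by (rule frechet_derivative_at[symmetric])
    (intro has_derivative_mult polynomial_function_has_derivative assms)

text \<open>The left-invariant vector field of \<open>X\<close>, with value \<open>A ** X\<close> at
  \<open>A\<close>, acts as a derivation on polynomial functions; sum and product rules reduce this
  to entries.\<close>

lemma polynomial_function_invariant_derivative:
  assumes "P \<in> polynomial_functions"
  shows "(\<lambda>A. frechet_derivative P (at A) (A ** X)) \<in> polynomial_functions"
  using assms
proof induction
  case (entry i j)
  show ?case
    by (simp add: frechet_derivative_entry polynomial_function_entry_mult_right)
next
  case (add P Q)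
  then show ?case
    by (simp add: frechet_derivative_polynomial_add polynomial_functions.add)
next
  case (mult P Q)
  then show ?case
    by (simp add: frechet_derivative_polynomial_mult polynomial_functions.intros)
qed (simp add: polynomial_functions.const)

lemma frechet_derivative_left_translate:
  assumes "P \<in> polynomial_functions"
  shows "frechet_derivative (\<lambda>A. P (B ** A)) (at A) X = frechet_derivative P (at (B ** A)) (B ** X)"
proof -
  have "linear (\<lambda>A. B ** A)"
    by (rule linearI)
      (simp_all add: matrix_matrix_mult_def vec_eq_iff sum.distrib scaleR_sum_right algebra_simps)
  then have "((\<lambda>A. B ** A) has_derivative (\<lambda>A. B ** A)) (at A)"
    by (intro bounded_linear_imp_has_derivative) (simp add: linear_conv_bounded_linear)
  from has_derivative_compose[OF this polynomial_function_has_derivative[OF assms]]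
  show ?thesis
    by (simp add: frechet_derivative_at[symmetric])
qed

text \<open>A chain rule with a complex derivative on the left and the real Frechet derivative on
  the right. Induction on \<open>P\<close> avoids proving complex linearity of the latter.\<close>

lemma polynomial_function_has_field_derivative_along_curve:
  fixes E :: "complex \<Rightarrow> complex ^ 'n ^ 'n"
  assumes "P \<in> polynomial_functions"
    and E: "\<And>i j. ((\<lambda>z. E z $ i $ j) has_field_derivative E' $ i $ j) (at z)"
  shows "((\<lambda>z. P (E z)) has_field_derivative frechet_derivative P (at (E z)) E') (at z)"
  using assms(1)
proof induction
  case (entry i j)
  show ?case
    by (simp add: frechet_derivative_entry E)
next
  case (add P Q)
  then show ?case
    by (simp add: frechet_derivative_polynomial_add DERIV_add)
next
  case (mult P Q)
  from DERIV_mult'[OF mult.IH] mult.hyps show ?case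
    by (simp add: frechet_derivative_polynomial_mult)
qed simp

lemma polynomial_function_on_line:
  assumes "P \<in> polynomial_functions"
  shows "\<exists>p. \<forall>z. P (A + mat_scale z B) = poly p z"
  using assms
proof induction
  case (const c)
  show ?case by (rule exI[of _ "[:c:]"]) simp
next
  case (entry i j)
  show ?case
    by (rule exI[of _ "[:A $ i $ j, B $ i $ j:]"]) (simp add: mat_scale_def)
next
  case (add P Q)
  then show ?case by (metis poly_add)
next
  case (mult P Q)
  then show ?case by (metis poly_mult)
qed

section \<open>Nilpotent parts\<close>

text \<open>Translating by \<open>B\<close> in \<open>G\<close> maps \<open>G\<close> into itself,
  so it preserves the ideal; the differential at \<open>B\<close> in direction \<open>B ** X\<close>
  is that of the translated function at the identity in direction \<open>X\<close>.\<close>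

lemma vanishing_ideal_invariant_derivative:
  assumes G: "subgroup G Aut" and X: "X \<in> lie_algebra_of G" and P: "P \<in> vanishing_ideal G"
  shows "(\<lambda>A. frechet_derivative P (at A) (A ** X)) \<in> vanishing_ideal G"
proof -
  have pol: "P \<in> polynomial_functions"
    using P by (simp add: vanishing_ideal_def)
  have "frechet_derivative P (at B) (B ** X) = 0" if "B \<in> G" for B
  proof -
    have "(\<lambda>A. P (B ** A)) \<in> vanishing_ideal G"
      using subgroup.m_closed[OF G that] P polynomial_function_left_translate[OF pol]
      by (simp add: vanishing_ideal_def Aut_def)
    then show ?thesis
      using X frechet_derivative_left_translate[OF pol, of B "mat 1" X]
      by (simp add: lie_algebra_of_def)
  qed
  then show ?thesis
    using polynomial_function_invariant_derivative[OF pol] by (simp add: vanishing_ideal_def)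
qed

text \<open>The hypotheses on \<open>E\<close> say E' = E X and E(0) = 1, so \<open>E\<close> stands
  for exp(z X) without a matrix exponential.\<close>

lemma vanishing_ideal_zero_along_integral_curve:
  fixes E :: "complex \<Rightarrow> complex ^ 'n ^ 'n"
  assumes G: "subgroup G Aut" and X: "X \<in> lie_algebra_of G"
    and E0: "E 0 = mat 1"
    and E: "\<And>z i j. ((\<lambda>z. E z $ i $ j) has_field_derivative (E z ** X) $ i $ j) (at z)"
    and P: "P \<in> vanishing_ideal G"
  shows "P (E z) = 0"
proof -
  have der: "((\<lambda>z. Q (E z)) has_field_derivative frechet_derivative Q (at (E z)) (E z ** X)) (at z)"
    if "Q \<in> vanishing_ideal G" for Q z
    using that
    by (intro polynomial_function_has_field_derivative_along_curve E) (simp add: vanishing_ideal_def)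
  \<comment> \<open>Each differentiation along \<open>E\<close> replaces the polynomial by its image
    under the invariant derivation, which stays in the ideal.\<close>
  have higher: "\<exists>Q \<in> vanishing_ideal G. (deriv ^^ n) (\<lambda>z. P (E z)) = (\<lambda>z. Q (E z))" for n
  proof (induction n)
    case 0
    show ?case using P by auto
  next
    case (Suc n)
    then obtain Q where Q: "Q \<in> vanishing_ideal G" "(deriv ^^ n) (\<lambda>z. P (E z)) = (\<lambda>z. Q (E z))"
      by blast
    have "(deriv ^^ Suc n) (\<lambda>z. P (E z)) = (\<lambda>z. frechet_derivative Q (at (E z)) (E z ** X))"
      using DERIV_imp_deriv[OF der[OF Q(1)]] by (auto simp: Q(2))
    then show ?case
      by (rule bexI[OF _ vanishing_ideal_invariant_derivative[OF G X Q(1)]])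
  qed
  have one: "mat 1 \<in> G"
    using subgroup.one_closed[OF G] by (simp add: Aut_def)
  have "(deriv ^^ n) (\<lambda>z. P (E z)) 0 = 0" for n
    using higher[of n] one E0 by (auto simp: vanishing_ideal_def)
  moreover have "(\<lambda>z. P (E z)) holomorphic_on UNIV"
    using der[OF P] by (auto simp: holomorphic_on_open)
  ultimately show ?thesis
    using holomorphic_fun_eq_0_on_connected[of "\<lambda>z. P (E z)" UNIV 0 z] by (simp add: connected_UNIV)
qed

lemma nilpotent_part_in_lie_algebra_of:
  fixes S N :: "complex ^ 'n ^ 'n"
  assumes G: "subgroup G Aut" and X: "S + N \<in> lie_algebra_of G" and "c \<noteq> 0"
    and SS: "S ** S = mat_scale c S" and SN: "S ** N = 0" and NS: "N ** S = 0" and NN: "N ** N = 0"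
  shows "N \<in> lie_algebra_of G"
proof -
  \<comment> \<open>Closed form of exp(z (S + N)): mixed products and N^2 vanish, and S^k = c^(k-1)
    S for k \<ge> 1.\<close>
  define E where "E z = mat 1 + mat_scale z N + mat_scale ((exp (c * z) - 1) / c) S" for z
  have scale_mult: "mat_scale a A ** B = mat_scale a (A ** B)" for a and A B :: "complex ^ 'n ^ 'n"
    by (simp add: matrix_matrix_mult_def mat_scale_def vec_eq_iff sum_distrib_left mult.assoc)
  have add_mult: "(A + B) ** C = A ** C + B ** C" for A B C :: "complex ^ 'n ^ 'n"
    by (simp add: matrix_matrix_mult_def vec_eq_iff sum.distrib distrib_right)
  have "E z ** (S + N) = N + mat_scale (exp (c * z)) S" for z
  proof -
    have "E z ** (S + N) = S + N + mat_scale ((exp (c * z) - 1) / c) (mat_scale c S)"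
      by (simp add: E_def matrix_add_ldistrib add_mult scale_mult SS SN NS NN)
    also have "\<dots> = N + mat_scale (exp (c * z)) S"
      using \<open>c \<noteq> 0\<close> by (simp add: mat_scale_def vec_eq_iff field_simps)
    finally show ?thesis .
  qed
  then have E: "((\<lambda>z. E z $ i $ j) has_field_derivative (E z ** (S + N)) $ i $ j) (at z)" for z i j
    unfolding E_def mat_scale_def using \<open>c \<noteq> 0\<close>
    by (auto intro!: derivative_eq_intros)
  have "E 0 = mat 1"
    by (simp add: E_def mat_scale_def vec_eq_iff)
  note zero = vanishing_ideal_zero_along_integral_curve[OF G X this E]
  have "frechet_derivative P (at (mat 1)) N = 0" if P: "P \<in> vanishing_ideal G" for P
  proof -
    have pol: "P \<in> polynomial_functions"
      using P by (simp add: vanishing_ideal_def)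
    then obtain p where p: "\<And>z. P (mat 1 + mat_scale z N) = poly p z"
      using polynomial_function_on_line by blast
    \<comment> \<open>Periods of exp(c z), where the coefficient of \<open>S\<close> in
      \<open>E\<close> vanishes.\<close>
    define w where "w m = 2 * of_real pi * \<i> * of_nat m / c" for m :: nat
    have "exp (c * w m) = 1" for m
      using \<open>c \<noteq> 0\<close> exp_integer_2pi[of "of_nat m"] by (simp add: w_def mult_ac)
    then have "E (w m) = mat 1 + mat_scale (w m) N" for m
      by (simp add: E_def mat_scale_def vec_eq_iff)
    then have "range w \<subseteq> {z. poly p z = 0}"
      using zero[OF P] p by (metis (mono_tags, lifting) image_subsetI mem_Collect_eq)
    moreover have "inj w"
      using \<open>c \<noteq> 0\<close> by (auto simp: inj_def w_def)
    ultimately have "infinite {z. poly p z = 0}"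
      using finite_subset range_inj_infinite by blast
    then have "p = 0"
      using poly_roots_finite by blast
    \<comment> \<open>The derivative of the zero polynomial is compared with dP(N).\<close>
    have "((\<lambda>z. P (mat 1 + mat_scale z N)) has_field_derivative
        frechet_derivative P (at (mat 1 + mat_scale 0 N)) N) (at 0)"
      by (rule polynomial_function_has_field_derivative_along_curve[OF pol])
        (auto simp: mat_scale_def intro!: derivative_eq_intros)
    then show ?thesis
      using DERIV_unique[OF _ DERIV_const] by (simp add: p \<open>p = 0\<close>)
  qed
  then show ?thesis by (simp add: lie_algebra_of_def)
qed

section \<open>The Lie algebra \<open>\<hh>\<close>\<close>

definition hmat :: "complex \<Rightarrow> complex \<Rightarrow> complex \<Rightarrow> complex \<Rightarrow> complex \<Rightarrow> complex ^ 4 ^ 4" where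
  "hmat \<alpha> \<beta> x1 x2 x3 = vector
     [vector [x1 + x2, x1 + x2, 0, x1],
      vector [x1 + x2, x1 + x2, 0, x2],
      vector [\<alpha> * x1 + (\<beta> - 1) * x2, \<beta> * x1 + (\<alpha> + 1) * x2, 0, x3],
      vector [0, 0, 0, 0]]"

lemma \<hh>_eq: "\<hh> \<alpha> \<beta> = {hmat \<alpha> \<beta> x1 x2 x3 | x1 x2 x3. True}"
  by (simp add: \<hh>_def hmat_def)

lemma hmat_in_\<hh>: "hmat \<alpha> \<beta> x1 x2 x3 \<in> \<hh> \<alpha> \<beta>"
  by (auto simp: \<hh>_eq)

lemma hmat_zero: "hmat \<alpha> \<beta> 0 0 0 = 0"
  by (simp add: hmat_def vec_eq_iff forall_4 vector_4)

lemma hmat_eq_iff: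
  "hmat \<alpha> \<beta> x1 x2 x3 = hmat \<alpha> \<beta> y1 y2 y3 \<longleftrightarrow> x1 = y1 \<and> x2 = y2 \<and> x3 = y3"
  by (auto simp: hmat_def vec_eq_iff forall_4 vector_4)

lemma hmat_add:
  "hmat \<alpha> \<beta> x1 x2 x3 + hmat \<alpha> \<beta> y1 y2 y3 = hmat \<alpha> \<beta> (x1 + y1) (x2 + y2) (x3 + y3)"
  by (simp add: hmat_def vec_eq_iff forall_4 vector_4 algebra_simps)

lemma hmat_scale: "mat_scale c (hmat \<alpha> \<beta> x1 x2 x3) = hmat \<alpha> \<beta> (c * x1) (c * x2) (c * x3)"
  by (simp add: hmat_def mat_scale_def vec_eq_iff forall_4 vector_4 algebra_simps)

text \<open>The relations of the Heisenberg algebra, with centre spanned by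
  \<open>hmat \<alpha> \<beta> 0 0 1\<close>; \<open>\<alpha>\<close> and \<open>\<beta>\<close>
  cancel.\<close>

lemma lie_bracket_hmat:
  "lie_bracket (hmat \<alpha> \<beta> x1 x2 x3) (hmat \<alpha> \<beta> y1 y2 y3) = hmat \<alpha> \<beta> 0 0 (x1 * y2 - x2 * y1)"
  by (simp add: lie_bracket_def hmat_def matrix_matrix_mult_def vec_eq_iff forall_4 sum_4 vector_4
      algebra_simps)

lemma subspace_\<hh>: "gl.subspace (\<hh> \<alpha> \<beta>)"
  unfolding gl.subspace_def
proof (intro conjI ballI allI)
  show "0 \<in> \<hh> \<alpha> \<beta>"
    by (metis hmat_zero hmat_in_\<hh>)
next
  fix A B assume "A \<in> \<hh> \<alpha> \<beta>" "B \<in> \<hh> \<alpha> \<beta>"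
  then show "A + B \<in> \<hh> \<alpha> \<beta>"
    unfolding \<hh>_eq using hmat_add by blast
next
  fix c A assume "A \<in> \<hh> \<alpha> \<beta>"
  then obtain x1 x2 x3 where "A = hmat \<alpha> \<beta> x1 x2 x3" by (auto simp: \<hh>_eq)
  then show "mat_scale c A \<in> \<hh> \<alpha> \<beta>"
    by (simp add: hmat_scale hmat_in_\<hh>)
qed

lemma lie_subalgebra_\<hh>: "lie_subalgebra (\<hh> \<alpha> \<beta>)"
  unfolding lie_subalgebra_def
proof (intro conjI ballI subspace_\<hh>)
  fix A B assume "A \<in> \<hh> \<alpha> \<beta>" "B \<in> \<hh> \<alpha> \<beta>"
  then show "lie_bracket A B \<in> \<hh> \<alpha> \<beta>"
    unfolding \<hh>_eq using lie_bracket_hmat by blast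
qed

lemma dim_\<hh>: "gl.dim (\<hh> \<alpha> \<beta>) = 3"
proof -
  let ?a = "hmat \<alpha> \<beta> 1 0 0" and ?b = "hmat \<alpha> \<beta> 0 1 0" and ?c = "hmat \<alpha> \<beta> 0 0 1"
  have span1: "gl.span {?c} = {hmat \<alpha> \<beta> 0 0 z | z. True}"
    by (auto simp: gl.span_singleton hmat_scale)
  have span2: "gl.span {?b, ?c} = {hmat \<alpha> \<beta> 0 y z | y z. True}"
    unfolding gl.span_insert[of ?b] span1
  proof (intro equalityI subsetI; clarsimp)
    fix x k z assume "x - mat_scale k ?b = hmat \<alpha> \<beta> 0 0 z"
    then have "x = hmat \<alpha> \<beta> 0 k z"
      by (simp add: diff_eq_eq hmat_scale hmat_add)
    then show "\<exists>y z. x = hmat \<alpha> \<beta> 0 y z" by blast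
  next
    fix y z
    have "hmat \<alpha> \<beta> 0 y z - mat_scale y ?b = hmat \<alpha> \<beta> 0 0 z"
      by (simp add: diff_eq_eq hmat_scale hmat_add)
    then show "\<exists>k za. hmat \<alpha> \<beta> 0 y z - mat_scale k ?b = hmat \<alpha> \<beta> 0 0 za" by blast
  qed
  have in_span: "\<hh> \<alpha> \<beta> \<subseteq> gl.span {?a, ?b, ?c}"
  proof
    fix A assume "A \<in> \<hh> \<alpha> \<beta>"
    then obtain x y z where A: "A = hmat \<alpha> \<beta> x y z" by (auto simp: \<hh>_eq)
    have "A - mat_scale x ?a = hmat \<alpha> \<beta> 0 y z"
      by (simp add: A diff_eq_eq hmat_scale hmat_add)
    then show "A \<in> gl.span {?a, ?b, ?c}"
      unfolding gl.span_insert[of ?a] span2 by blast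
  qed
  \<comment> \<open>Independence by adjoining one vector at a time. Writing 0 as
    \<open>hmat \<alpha> \<beta> 0 0 0\<close> lets \<open>hmat_eq_iff\<close> decide by
    coordinates.\<close>
  have "?a \<notin> gl.span {?b, ?c}" "?b \<notin> gl.span {?c}" "?c \<noteq> 0"
    unfolding span1 span2 by (auto simp: hmat_eq_iff simp flip: hmat_zero[of \<alpha> \<beta>])
  then have "gl.independent {?a, ?b, ?c}"
    by (simp add: gl.independent_insert hmat_eq_iff)
  with in_span have "gl.dim (\<hh> \<alpha> \<beta>) = card {?a, ?b, ?c}"
    by (intro gl.dim_unique[of "{?a, ?b, ?c}"]) (auto simp: hmat_in_\<hh>)
  also have "\<dots> = 3"
    by (simp add: hmat_eq_iff)
  finally show ?thesis .
qed

lemma nilpotent_\<hh>: "nilpotent_lie (\<hh> \<alpha> \<beta>)"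
proof -
  \<comment> \<open>The centre: it contains all brackets, and bracketing with it gives 0, so the
    series stops after two steps.\<close>
  let ?Z = "{hmat \<alpha> \<beta> 0 0 z | z. True}"
  have "gl.subspace ?Z"
    unfolding gl.subspace_def
    by (auto simp: hmat_add hmat_scale) (metis hmat_zero)
  moreover have "{lie_bracket A B | A B. A \<in> \<hh> \<alpha> \<beta> \<and> B \<in> \<hh> \<alpha> \<beta>} \<subseteq> ?Z"
    by (auto simp: \<hh>_eq lie_bracket_hmat)
  ultimately have "lower_central_series (\<hh> \<alpha> \<beta>) 1 \<subseteq> ?Z"
    by (simp add: gl.span_minimal)
  then have "{lie_bracket A B | A B. A \<in> \<hh> \<alpha> \<beta> \<and> B \<in> lower_central_series (\<hh> \<alpha> \<beta>) 1} \<subseteq> {0}"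
    by (fastforce simp: \<hh>_eq lie_bracket_hmat hmat_zero)
  then have "lower_central_series (\<hh> \<alpha> \<beta>) (Suc 1) = {0}"
    using gl.span_minimal[OF _ gl.subspace_single_0] gl.span_zero
    unfolding lower_central_series.simps(2) by blast
  then show ?thesis
    unfolding nilpotent_lie_def by blast
qed

lemma not_algebraic_\<hh>: "\<not> algebraic_lie_subalgebra (\<hh> \<alpha> \<beta>)"
proof
  assume "algebraic_lie_subalgebra (\<hh> \<alpha> \<beta>)"
  then obtain G where G: "subgroup G Aut" and L: "\<hh> \<alpha> \<beta> = lie_algebra_of G"
    by (auto simp: algebraic_lie_subalgebra_def algebraic_group_def)
  \<comment> \<open>\<open>X = hmat \<alpha> \<beta> (1/2) (1/2) _\<close> satisfies \<open>X\<^sup>3 = 2 X\<^sup>2\<close>, so \<open>S = X\<^sup>2 / 2\<close>.\<close>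
  define S :: "complex ^ 4 ^ 4" where "S = vector
    [vector [1, 1, 0, 1/2], vector [1, 1, 0, 1/2],
     vector [(\<alpha> + \<beta>) / 2, (\<alpha> + \<beta>) / 2, 0, (\<alpha> + \<beta>) / 4], vector [0, 0, 0, 0]]"
  define N :: "complex ^ 4 ^ 4" where "N = vector
    [vector [0, 0, 0, 0], vector [0, 0, 0, 0], vector [-1/2, 1/2, 0, 0], vector [0, 0, 0, 0]]"
  note entries = S_def N_def hmat_def mat_scale_def matrix_matrix_mult_def vec_eq_iff forall_4
    sum_4 vector_4
  \<comment> \<open>The third coordinate is chosen to make the (3,4) entry of \<open>N\<close>
    vanish.\<close>
  have "S + N = hmat \<alpha> \<beta> (1/2) (1/2) ((\<alpha> + \<beta>) / 4)"
    by (simp add: entries field_simps)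
  then have "S + N \<in> lie_algebra_of G"
    using hmat_in_\<hh> by (simp flip: L)
  then have "N \<in> \<hh> \<alpha> \<beta>"
    unfolding L
    \<comment> \<open>2 is the nonzero eigenvalue of the all-ones upper left block.
      \<open>N ** S\<close> vanishes because the first two rows of \<open>S\<close> agree.\<close>
    by (rule nilpotent_part_in_lie_algebra_of[OF G, where c = 2]) (simp_all add: entries)
  then obtain x1 x2 x3 where "N = hmat \<alpha> \<beta> x1 x2 x3"
    by (auto simp: \<hh>_eq)
  \<comment> \<open>The last column of \<open>N\<close> forces x1 = x2 = 0, hence a zero (3,1)
    entry, but that entry of \<open>N\<close> is -1/2.\<close>
  then show False
    by (auto simp: entries)
qed

theorem theorem3:
  fixes \<alpha> \<beta> :: complex
  assumes "\<alpha> + \<beta> \<noteq> 0"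
  shows "lie_subalgebra (\<hh> \<alpha> \<beta>) \<and> gl.dim (\<hh> \<alpha> \<beta>) = 3 \<and> nilpotent_lie (\<hh> \<alpha> \<beta>) \<and>
    \<not> algebraic_lie_subalgebra (\<hh> \<alpha> \<beta>)"
  using lie_subalgebra_\<hh> dim_\<hh> nilpotent_\<hh> not_algebraic_\<hh> by blast

end
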